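(* Let $Y$ be a finite-dimensional real Hilbert space and let $X=Y\times Y$. Given $\alpha>0$, $\varepsilon>0$, and $(u,v)\in X$, the unique maximizer over $(x,y)\in X$ of the function $$(x,y)\mapsto \langle u,x\rangle+\langle v,y\rangle-\alpha\tfrac12\|x-y\|^2-\varepsilon\tfrac12\big(\|x\|^2+\|y\|^2\big)$$ is $$(x,y)=\frac{1}{(2\alpha+\varepsilon)\varepsilon}\big((\alpha+\varepsilon)u+\alpha v,\ (\alpha+\varepsilon)v+\alpha u\big).$$
   Context: $Y$ is a finite-dimensional real Hilbert space with inner product $\langle\cdot,\cdot\rangle$ and induced norm $\|\cdot\|$; $X=Y\times Y$ is the product Hilbert space. *)

theory Defs
  imports "HOL-Analysis.Analysis"
begin

end

theory Submission
  imports Defs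
begin

text \<open>
  The objective is a quadratic function whose quadratic part
  \<open>-\<alpha>/2 \<parallel>x - y\<parallel>\<^sup>2 - \<epsilon>/2 (\<parallel>x\<parallel>\<^sup>2 + \<parallel>y\<parallel>\<^sup>2)\<close> is negative definite. At a critical point \<open>(a, b)\<close> the
  linear terms of the expansion around \<open>(a, b)\<close> vanish, so the loss incurred by moving from
  \<open>(a, b)\<close> to \<open>(x, y)\<close> is exactly the positive definite quadratic form evaluated at
  \<open>(x - a, y - b)\<close> (lemma \<open>gap_at_critical_point\<close>). Hence a critical point is the unique
  maximizer. The critical point equations are
  \<open>(\<alpha> + \<epsilon>) a - \<alpha> b = u\<close> and \<open>(\<alpha> + \<epsilon>) b - \<alpha> a = v\<close>, a linear system with determinant
  \<open>(\<alpha> + \<epsilon>)\<^sup>2 - \<alpha>\<^sup>2 = (2 \<alpha> + \<epsilon>) \<epsilon> > 0\<close>; Cramer's rule gives the stated formula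
  (lemma \<open>critical_point_equation\<close>).
\<close>

text \<open>
  Expanding around \<open>(a, b)\<close> leaves no linear term, because the two vectors paired with \<open>x\<close>
  and \<open>y\<close> on the left are the gradient of the quadratic form at \<open>(a, b)\<close>.
\<close>

lemma gap_at_critical_point:
  fixes a b x y :: "'y::real_inner" and \<alpha> \<epsilon> :: real
  assumes u: "u = (\<alpha> + \<epsilon>) *\<^sub>R a - \<alpha> *\<^sub>R b"
    and v: "v = (\<alpha> + \<epsilon>) *\<^sub>R b - \<alpha> *\<^sub>R a"
  shows "(u \<bullet> a + v \<bullet> b - \<alpha> * (1/2) * (norm (a - b))\<^sup>2
            - \<epsilon> * (1/2) * ((norm a)\<^sup>2 + (norm b)\<^sup>2))
       - (u \<bullet> x + v \<bullet> y - \<alpha> * (1/2) * (norm (x - y))\<^sup>2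
            - \<epsilon> * (1/2) * ((norm x)\<^sup>2 + (norm y)\<^sup>2))
       = \<alpha> / 2 * (norm ((x - a) - (y - b)))\<^sup>2
         + \<epsilon> / 2 * ((norm (x - a))\<^sup>2 + (norm (y - b))\<^sup>2)"
  unfolding u v power2_norm_eq_inner
  by (simp add: inner_add_left inner_diff_left inner_diff_right inner_commute[of x a]
      inner_commute[of y a] inner_commute[of x b] inner_commute[of y b] inner_commute[of y x]
      inner_commute[of b a]) (simp add: field_simps)

lemma critical_point_equation:
  fixes p q :: "'y::real_vector" and \<alpha> \<epsilon> :: real
  assumes "(2 * \<alpha> + \<epsilon>) * \<epsilon> \<noteq> 0"
  defines "c \<equiv> 1 / ((2 * \<alpha> + \<epsilon>) * \<epsilon>)"
  shows "p = (\<alpha> + \<epsilon>) *\<^sub>R (c *\<^sub>R ((\<alpha> + \<epsilon>) *\<^sub>R p + \<alpha> *\<^sub>R q))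
           - \<alpha> *\<^sub>R (c *\<^sub>R ((\<alpha> + \<epsilon>) *\<^sub>R q + \<alpha> *\<^sub>R p))"
proof -
  \<comment> \<open>The coefficient of \<open>q\<close> cancels and that of \<open>p\<close> is \<open>c\<close> times the determinant.\<close>
  have "(\<alpha> + \<epsilon>) *\<^sub>R (c *\<^sub>R ((\<alpha> + \<epsilon>) *\<^sub>R p + \<alpha> *\<^sub>R q))
          - \<alpha> *\<^sub>R (c *\<^sub>R ((\<alpha> + \<epsilon>) *\<^sub>R q + \<alpha> *\<^sub>R p))
        = (c * ((2 * \<alpha> + \<epsilon>) * \<epsilon>)) *\<^sub>R p"
    by (simp add: algebra_simps flip: scaleR_left_distrib)
  also have "c * ((2 * \<alpha> + \<epsilon>) * \<epsilon>) = 1"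
    unfolding c_def using assms(1) by simp
  finally show ?thesis by simp
qed

lemma is_arg_max_unique_iff:
  fixes f :: "'a \<Rightarrow> 'b::linorder"
  assumes "\<And>p. p \<noteq> p0 \<Longrightarrow> f p < f p0"
  shows "is_arg_max f (\<lambda>p. p \<in> UNIV) p \<longleftrightarrow> p = p0"
  unfolding is_arg_max_def using assms by (metis UNIV_I order_less_asym order_less_irrefl)

theorem proposition4p3:
  fixes u v :: "'y::real_inner" and \<alpha> \<epsilon> :: real
  assumes "\<exists>B::'y set. finite B \<and> span B = UNIV"
    and "\<alpha> > 0" and "\<epsilon> > 0"
  shows "\<forall>p::'y \<times> 'y.
    is_arg_max
      (\<lambda>(x, y). u \<bullet> x + v \<bullet> y - \<alpha> * (1/2) * (norm (x - y))\<^sup>2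
                - \<epsilon> * (1/2) * ((norm x)\<^sup>2 + (norm y)\<^sup>2))
      (\<lambda>p. p \<in> UNIV) p
    \<longleftrightarrow> p = (1 / ((2 * \<alpha> + \<epsilon>) * \<epsilon>)) *\<^sub>R
            ((\<alpha> + \<epsilon>) *\<^sub>R u + \<alpha> *\<^sub>R v, (\<alpha> + \<epsilon>) *\<^sub>R v + \<alpha> *\<^sub>R u)"
proof -
  define c where "c = 1 / ((2 * \<alpha> + \<epsilon>) * \<epsilon>)"
  define a where "a = c *\<^sub>R ((\<alpha> + \<epsilon>) *\<^sub>R u + \<alpha> *\<^sub>R v)"
  define b where "b = c *\<^sub>R ((\<alpha> + \<epsilon>) *\<^sub>R v + \<alpha> *\<^sub>R u)"
  define f where "f = (\<lambda>(x, y). u \<bullet> x + v \<bullet> y - \<alpha> * (1/2) * (norm (x - y))\<^sup>2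
                - \<epsilon> * (1/2) * ((norm x)\<^sup>2 + (norm y)\<^sup>2))"
  have det: "(2 * \<alpha> + \<epsilon>) * \<epsilon> \<noteq> 0"
    using assms(2,3) by simp
  have u: "u = (\<alpha> + \<epsilon>) *\<^sub>R a - \<alpha> *\<^sub>R b"
    unfolding a_def b_def c_def by (rule critical_point_equation[OF det])
  have v: "v = (\<alpha> + \<epsilon>) *\<^sub>R b - \<alpha> *\<^sub>R a"
    unfolding a_def b_def c_def by (rule critical_point_equation[OF det])
  have less: "f (x, y) < f (a, b)" if "(x, y) \<noteq> (a, b)" for x y
  proof -
    have "0 < (norm (x - a))\<^sup>2 + (norm (y - b))\<^sup>2"
      using that unfolding sum_power2_gt_zero_iff by simp
    then have "0 < \<alpha> / 2 * (norm ((x - a) - (y - b)))\<^sup>2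
         + \<epsilon> / 2 * ((norm (x - a))\<^sup>2 + (norm (y - b))\<^sup>2)"
      using assms(2,3) by (intro add_nonneg_pos[OF mult_nonneg_nonneg mult_pos_pos]) simp_all
    also have "\<dots> = f (a, b) - f (x, y)"
      unfolding f_def prod.case by (rule gap_at_critical_point[OF u v, symmetric])
    finally show ?thesis by simp
  qed
  have "f p < f (a, b)" if "p \<noteq> (a, b)" for p
    using less[of "fst p" "snd p"] that by simp
  from is_arg_max_unique_iff[of "(a, b)" f, OF this]
  have "is_arg_max f (\<lambda>p. p \<in> UNIV) p \<longleftrightarrow> p = (a, b)" for p .
  then show ?thesis
    unfolding f_def a_def b_def c_def by simp
qed

end
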